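(* There exist a may-must argumentation $(A, R, f_Q) \in \mathcal{F}$ and some $a \in A$ such that, for every $\lambda \in \Lambda^A$, $\lambda$ designates, for $a$, some $l \in \mathcal{L}$ with $l \neq \lambda(a)$.
   Context: $\mathbb{N}$ includes $0$. $\mathcal{A}$ is a class of abstract entities called arguments. $\mathcal{L} = \{\mathsf{in}, \mathsf{out}, \mathsf{undec}\}$. $\Lambda$ is the class of all partial functions $\mathcal{A} \to \mathcal{L}$, and for $A \subseteq \mathcal{A}$, $\Lambda^A$ is the class of those $\lambda\in\Lambda$ defined exactly on $A$. A may-must argumentation is a tuple $F = (A, R, f_Q)$ with $A \subseteq \mathcal{A}$ finite, $R \subseteq A \times A$ (the attack relation; $(a_1,a_2)\in R$ means $a_1$ attacks $a_2$), and $f_Q : A \to (\mathbb{N}\times\mathbb{N})\times(\mathbb{N}\times\mathbb{N})$ such that, writing $f_Q(a) = ((n_1^a, n_2^a),(m_1^a,m_2^a))$, one has $n_1^a \le n_2^a$ and $m_1^a \le m_2^a$ for every $a\in A$. $\mathcal{F}$ denotes the class of all may-must argumentations. For $a \in A$, $\mathsf{pred}^F(a) = \{a_x \in A \mid (a_x,a)\in R\}$; for $\lambda\in\Lambda$, $\mathsf{pred}^F_{\lambda,\mathsf{in}}(a)$ (resp. $\mathsf{pred}^F_{\lambda,\mathsf{out}}(a)$) is the set of those $a_x \in \mathsf{pred}^F(a)$ for which $\lambda$ is defined and $\lambda(a_x)=\mathsf{in}$ (resp. $\mathsf{out}$). Satisfaction (for $\lambda \in \Lambda$ and $a\in A$ for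 which $\lambda$ is defined), with $o = |\mathsf{pred}^F_{\lambda,\mathsf{out}}(a)|$ and $i=|\mathsf{pred}^F_{\lambda,\mathsf{in}}(a)|$: under $\lambda$ in $F$, $a$ satisfies may-a iff $n_1^a \le o$; must-a iff $n_2^a \le o$; may$_s$-a iff $n_1^a \le o < n_2^a$; not-a iff $o < n_1^a$; may-r iff $m_1^a \le i$; must-r iff $m_2^a \le i$; may$_s$-r iff $m_1^a \le i < m_2^a$; not-r iff $i < m_1^a$. Designation: $\lambda\in\Lambda$ designates $l \in \mathcal{L}$ for $a\in A$ (in $F$) iff (1) $\lambda$ is defined for every member of $\mathsf{pred}^F(a)$; (2) if $l=\mathsf{in}$, then $a$ satisfies may-a but not must-r; (3) if $l = \mathsf{out}$, then $a$ satisfies may-r but not must-a; (4) if $l=\mathsf{undec}$, then at least one of the following holds: $a$ satisfies both must-a and must-r; $a$ satisfies at least one of may$_s$-a, may$_s$-r; $a$ satisfies both not-a and not-r. *)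

theory Defs imports Main begin

datatype label = In | Out | Undec

text \<open>
  The type \<open>'a\<close> plays the role of the class of all arguments. The third component of a
  tuple is a total function, of which only the values on the first component matter.
\<close>

type_synonym 'a argumentation =
  "'a set \<times> ('a \<times> 'a) set \<times> ('a \<Rightarrow> (nat \<times> nat) \<times> (nat \<times> nat))"

type_synonym 'a labelling = "'a \<rightharpoonup> label"

definition labellings_on :: "'a set \<Rightarrow> 'a labelling set" where
  "labellings_on A = {lam. dom lam = A}"

fun args :: "'a argumentation \<Rightarrow> 'a set" where
  "args (A, R, f) = A"

fun attacks :: "'a argumentation \<Rightarrow> ('a \<times> 'a) set" where
  "attacks (A, R, f) = R"

fun quant :: "'a argumentation \<Rightarrow> 'a \<Rightarrow> (nat \<times> nat) \<times> (nat \<times> nat)" where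
  "quant (A, R, f) = f"

definition n1 :: "'a argumentation \<Rightarrow> 'a \<Rightarrow> nat" where "n1 F a = fst (fst (quant F a))"
definition n2 :: "'a argumentation \<Rightarrow> 'a \<Rightarrow> nat" where "n2 F a = snd (fst (quant F a))"
definition m1 :: "'a argumentation \<Rightarrow> 'a \<Rightarrow> nat" where "m1 F a = fst (snd (quant F a))"
definition m2 :: "'a argumentation \<Rightarrow> 'a \<Rightarrow> nat" where "m2 F a = snd (snd (quant F a))"

definition may_must_argumentations :: "'a argumentation set" where
  "may_must_argumentations =
    {F. finite (args F) \<and> attacks F \<subseteq> args F \<times> args F \<and>
        (\<forall>a\<in>args F. n1 F a \<le> n2 F a \<and> m1 F a \<le> m2 F a)}"

definition pred :: "'a argumentation \<Rightarrow> 'a \<Rightarrow> 'a set" where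
  "pred F a = {x \<in> args F. (x, a) \<in> attacks F}"

definition pred_lab :: "'a argumentation \<Rightarrow> 'a labelling \<Rightarrow> label \<Rightarrow> 'a \<Rightarrow> 'a set" where
  "pred_lab F lam l a = {x \<in> pred F a. lam x = Some l}"

text \<open>
  The satisfaction predicates are meant for arguments on which the labelling is defined;
  the counts themselves depend only on the labels of the attackers.
\<close>

definition num_out :: "'a argumentation \<Rightarrow> 'a labelling \<Rightarrow> 'a \<Rightarrow> nat" where
  "num_out F lam a = card (pred_lab F lam Out a)"

definition num_in :: "'a argumentation \<Rightarrow> 'a labelling \<Rightarrow> 'a \<Rightarrow> nat" where
  "num_in F lam a = card (pred_lab F lam In a)"

definition may_a :: "'a argumentation \<Rightarrow> 'a labelling \<Rightarrow> 'a \<Rightarrow> bool" where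
  "may_a F lam a \<longleftrightarrow> n1 F a \<le> num_out F lam a"

definition must_a :: "'a argumentation \<Rightarrow> 'a labelling \<Rightarrow> 'a \<Rightarrow> bool" where
  "must_a F lam a \<longleftrightarrow> n2 F a \<le> num_out F lam a"

definition mays_a :: "'a argumentation \<Rightarrow> 'a labelling \<Rightarrow> 'a \<Rightarrow> bool" where
  "mays_a F lam a \<longleftrightarrow> n1 F a \<le> num_out F lam a \<and> num_out F lam a < n2 F a"

definition not_a :: "'a argumentation \<Rightarrow> 'a labelling \<Rightarrow> 'a \<Rightarrow> bool" where
  "not_a F lam a \<longleftrightarrow> num_out F lam a < n1 F a"

definition may_r :: "'a argumentation \<Rightarrow> 'a labelling \<Rightarrow> 'a \<Rightarrow> bool" where
  "may_r F lam a \<longleftrightarrow> m1 F a \<le> num_in F lam a"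

definition must_r :: "'a argumentation \<Rightarrow> 'a labelling \<Rightarrow> 'a \<Rightarrow> bool" where
  "must_r F lam a \<longleftrightarrow> m2 F a \<le> num_in F lam a"

definition mays_r :: "'a argumentation \<Rightarrow> 'a labelling \<Rightarrow> 'a \<Rightarrow> bool" where
  "mays_r F lam a \<longleftrightarrow> m1 F a \<le> num_in F lam a \<and> num_in F lam a < m2 F a"

definition not_r :: "'a argumentation \<Rightarrow> 'a labelling \<Rightarrow> 'a \<Rightarrow> bool" where
  "not_r F lam a \<longleftrightarrow> num_in F lam a < m1 F a"

definition designates :: "'a argumentation \<Rightarrow> 'a labelling \<Rightarrow> label \<Rightarrow> 'a \<Rightarrow> bool" where
  "designates F lam l a \<longleftrightarrow>
    pred F a \<subseteq> dom lam \<and>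
    (l = In \<longrightarrow> may_a F lam a \<and> \<not> must_r F lam a) \<and>
    (l = Out \<longrightarrow> may_r F lam a \<and> \<not> must_a F lam a) \<and>
    (l = Undec \<longrightarrow>
      (must_a F lam a \<and> must_r F lam a) \<or>
      (mays_a F lam a \<or> mays_r F lam a) \<or>
      (not_a F lam a \<and> not_r F lam a))"

end

theory Submission imports Defs begin

text \<open>
  The witness is a single self-attacking argument that must always be accepted and must be
  rejected as soon as it is labelled \<open>In\<close>: the label \<open>In\<close> then designates only \<open>Undec\<close>, and the
  labels \<open>Out\<close> and \<open>Undec\<close> designate only \<open>In\<close>. So the designated label is unique and always wrong.
\<close>

theorem theorem1:
  "\<exists>(A :: 'a set) R f\<^sub>Q. (A, R, f\<^sub>Q) \<in> may_must_argumentations \<and>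
    (\<exists>a\<in>A. \<forall>lam\<in>labellings_on A.
      \<exists>l. designates (A, R, f\<^sub>Q) lam l a \<and> Some l \<noteq> lam a)"
proof -
  fix a :: 'a
  \<comment> \<open>The thresholds 0 make \<open>may_a\<close> and \<open>must_a\<close> hold under
    every labelling; the thresholds 1 make \<open>must_r\<close> hold exactly when \<open>a\<close>,
    its own sole attacker, is labelled \<open>In\<close>.\<close>
  define F :: "'a argumentation" where "F = ({a}, {(a, a)}, \<lambda>_. ((0, 0), (1, 1)))"
  have F: "F \<in> may_must_argumentations"
    by (simp add: F_def may_must_argumentations_def n1_def n2_def m1_def m2_def)
  have pred: "pred F a = {a}"
    by (auto simp: F_def pred_def)
  have num_in: "num_in F lam a = (if lam a = Some In then 1 else 0)" for lam
  proof -
    have "pred_lab F lam In a = (if lam a = Some In then {a} else {})"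
      by (auto simp: pred_lab_def pred)
    then show ?thesis
      by (simp add: num_in_def)
  qed
  have quant: "n1 F a = 0" "n2 F a = 0" "m2 F a = 1"
    by (simp_all add: F_def n1_def n2_def m2_def)
  have "\<exists>l. designates F lam l a \<and> Some l \<noteq> lam a" if "lam \<in> labellings_on {a}" for lam
  proof (intro exI conjI)
    \<comment> \<open>If \<open>lam a = Some In\<close>, then \<open>must_a\<close> and
      \<open>must_r\<close> hold together, which permits \<open>Undec\<close>; otherwise
      \<open>may_a\<close> holds without \<open>must_r\<close>, which permits
      \<open>In\<close>.\<close>
    let ?l = "if lam a = Some In then Undec else In"
    \<comment> \<open>Designation requires every attacker to be labelled, here only \<open>a\<close>
      itself.\<close>
    have "a \<in> dom lam"
      using that by (simp add: labellings_on_def)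
    then show "designates F lam ?l a"
      by (simp add: designates_def pred may_a_def must_a_def must_r_def num_in quant)
    show "Some ?l \<noteq> lam a"
      by auto
  qed
  with F show ?thesis
    unfolding F_def by blast
qed

end
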